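(* Let $r\ge 3$, let $B$ be a partially reduced basis of the free group $F_r$, and let $u\in B$. Then $u$ does not contain a primitivity-blocking subword.
   Context: $F_r$ is the free group of rank $r$ with fixed basis $x_1,\dots,x_r$; elements are identified with freely reduced words in the letters $x_i^{\pm1}$, and first letters and subwords (contiguous) refer to these reduced words. A basis of $F_r$ means a free generating set. A basis $B$ is partially reduced if there exists a proper subset $X$ of $B$ such that there are non-trivial words $w,v\in\langle X\rangle$ (the subgroup generated by $X$) that do not begin with the same letter. An element $u\in F_r$ is primitive if some automorphism of $F_r$ takes $x_1$ to $u$. A word $v$ is primitivity-blocking if for every $\varphi\in\operatorname{Aut}(F_r)$, $v$ is not a subword of the cyclic reduction of $\varphi(x_1)$; equivalently, $v$ is not a subword of any cyclically reduced primitive element of $F_r$. *)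

theory Defs
  imports "HOL-Algebra.Algebra" "HOL-Library.Sublist"
begin

section \<open>Freely reduced words and free groups\<close>

text \<open>The letter \<open>(x, True)\<close> stands for the generator \<open>x\<close>, and \<open>(x, False)\<close> for its inverse.\<close>

type_synonym 'a letter = "'a \<times> bool"

definition inv_letter :: "'a letter \<Rightarrow> 'a letter" where
  "inv_letter a = (fst a, \<not> snd a)"

definition reduced :: "'a letter list \<Rightarrow> bool" where
  "reduced w \<longleftrightarrow> successively (\<lambda>a b. b \<noteq> inv_letter a) w"

fun cons_reduce :: "'a letter \<Rightarrow> 'a letter list \<Rightarrow> 'a letter list" where
  "cons_reduce a [] = [a]"
| "cons_reduce a (b # w) = (if b = inv_letter a then w else a # b # w)"

definition free_reduction :: "'a letter list \<Rightarrow> 'a letter list" where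
  "free_reduction w = foldr cons_reduce w []"

definition free_group :: "'a set \<Rightarrow> 'a letter list monoid" where
  "free_group S =
    \<lparr>carrier = {w. reduced w \<and> fst ` set w \<subseteq> S},
     monoid.mult = (\<lambda>u v. free_reduction (u @ v)),
     one = []\<rparr>"

abbreviation F :: "nat \<Rightarrow> nat letter list monoid" where
  "F r \<equiv> free_group {1..r}"

abbreviation gen :: "nat \<Rightarrow> nat letter list" where
  "gen i \<equiv> [(i, True)]"

lemma inv_letter_inv_letter [simp]: "inv_letter (inv_letter a) = a"
  by (simp add: inv_letter_def)

lemma fst_inv_letter [simp]: "fst (inv_letter a) = fst a"
  by (simp add: inv_letter_def)

lemma reduced_Nil [simp]: "reduced []"
  by (simp add: reduced_def)

lemma reduced_ConsD: "reduced (a # w) \<Longrightarrow> reduced w"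
  by (cases w) (auto simp: reduced_def)

lemma reduced_cons_reduce: "reduced w \<Longrightarrow> reduced (cons_reduce a w)"
  by (cases w) (auto simp: reduced_def successively_Cons)

lemma reduced_foldr: "reduced v \<Longrightarrow> reduced (foldr cons_reduce u v)"
  by (induction u) (auto intro: reduced_cons_reduce)

lemma free_reduction_reduced: "reduced w \<Longrightarrow> free_reduction w = w"
proof (induction w)
  case (Cons a w)
  then show ?case
    using reduced_ConsD[of a w]
    by (cases w) (auto simp: reduced_def free_reduction_def)
qed (simp add: free_reduction_def)

lemma free_reduction_append:
  "reduced v \<Longrightarrow> free_reduction (u @ v) = foldr cons_reduce u v"
  using free_reduction_reduced[of v] by (simp add: free_reduction_def)

lemma cons_reduce_cancel: "reduced w \<Longrightarrow> cons_reduce a (cons_reduce (inv_letter a) w) = w"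
  by (cases w rule: remdups_adj.cases) (auto simp: reduced_def)

lemma foldr_cons_reduce:
  assumes "reduced v"
  shows "foldr cons_reduce (cons_reduce a u) v = cons_reduce a (foldr cons_reduce u v)"
  using assms by (cases u) (auto simp: cons_reduce_cancel reduced_foldr)

lemma foldr_foldr_cons_reduce:
  "reduced w \<Longrightarrow> foldr cons_reduce (foldr cons_reduce u v) w
     = foldr cons_reduce u (foldr cons_reduce v w)"
  by (induction u) (auto simp: foldr_cons_reduce)

lemma set_cons_reduce: "set (cons_reduce a w) \<subseteq> insert a (set w)"
  by (cases w) auto

lemma set_foldr_cons_reduce: "set (foldr cons_reduce u v) \<subseteq> set u \<union> set v"
  by (induction u) (use set_cons_reduce in fastforce)+

lemma foldr_inverse:
  "foldr cons_reduce (map inv_letter (rev w) @ w) [] = []"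
proof (induction w)
  case (Cons a w)
  have "reduced (foldr cons_reduce w [])"
    by (simp add: reduced_foldr)
  from cons_reduce_cancel[OF this, of "inv_letter a"] Cons show ?case
    by simp
qed simp

lemma reduced_inverse: "reduced w \<Longrightarrow> reduced (map inv_letter (rev w))"
  unfolding reduced_def successively_map successively_rev
  by (erule successively_mono) (metis inv_letter_inv_letter)+

lemma group_free_group: "group (free_group S)"
proof (rule groupI)
  fix u v assume "u \<in> carrier (free_group S)" "v \<in> carrier (free_group S)"
  then show "u \<otimes>\<^bsub>free_group S\<^esub> v \<in> carrier (free_group S)"
    using set_foldr_cons_reduce[of u v]
    by (fastforce simp: free_group_def free_reduction_append reduced_foldr)
next
  fix u v w
  assume "u \<in> carrier (free_group S)" "v \<in> carrier (free_group S)" "w \<in> carrier (free_group S)"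
  then show "u \<otimes>\<^bsub>free_group S\<^esub> v \<otimes>\<^bsub>free_group S\<^esub> w
      = u \<otimes>\<^bsub>free_group S\<^esub> (v \<otimes>\<^bsub>free_group S\<^esub> w)"
    by (simp add: free_group_def free_reduction_append reduced_foldr foldr_foldr_cons_reduce
             del: foldr_append)
next
  fix u assume u: "u \<in> carrier (free_group S)"
  then have "map inv_letter (rev u) \<in> carrier (free_group S)"
    by (auto simp: free_group_def reduced_inverse)
  moreover have "map inv_letter (rev u) \<otimes>\<^bsub>free_group S\<^esub> u = \<one>\<^bsub>free_group S\<^esub>"
    using foldr_inverse[of u] by (simp add: free_group_def free_reduction_def)
  ultimately show "\<exists>v\<in>carrier (free_group S). v \<otimes>\<^bsub>free_group S\<^esub> u = \<one>\<^bsub>free_group S\<^esub>"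
    by blast
qed (auto simp: free_group_def free_reduction_reduced)


section \<open>Bases\<close>

fun word_value :: "('g, 'm) monoid_scheme \<Rightarrow> 'g letter list \<Rightarrow> 'g" where
  "word_value G [] = \<one>\<^bsub>G\<^esub>"
| "word_value G ((g, s) # w) = (if s then g else inv\<^bsub>G\<^esub> g) \<otimes>\<^bsub>G\<^esub> word_value G w"

text \<open>Freeness: no nonempty reduced word in the formal letters \<open>b\<close>, \<open>b\<inverse>\<close> with \<open>b \<in> B\<close>
  represents the identity.\<close>

definition free_generating_set :: "('g, 'm) monoid_scheme \<Rightarrow> 'g set \<Rightarrow> bool" where
  "free_generating_set G B \<longleftrightarrow>
     B \<subseteq> carrier G \<and> generate G B = carrier G \<and>
     (\<forall>w. reduced w \<and> fst ` set w \<subseteq> B \<and> w \<noteq> [] \<longrightarrow> word_value G w \<noteq> \<one>\<^bsub>G\<^esub>)"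

definition basis :: "nat \<Rightarrow> nat letter list set \<Rightarrow> bool" where
  "basis r B \<longleftrightarrow> free_generating_set (F r) B"

definition partially_reduced :: "nat \<Rightarrow> nat letter list set \<Rightarrow> bool" where
  "partially_reduced r B \<longleftrightarrow>
     (\<exists>Y. Y \<subset> B \<and>
        (\<exists>w \<in> generate (F r) Y. \<exists>v \<in> generate (F r) Y. w \<noteq> [] \<and> v \<noteq> [] \<and> hd w \<noteq> hd v))"


section \<open>Primitivity-blocking words\<close>

function cyclic_reduction :: "'a letter list \<Rightarrow> 'a letter list" where
  "cyclic_reduction w =
     (if w \<noteq> [] \<and> last w = inv_letter (hd w) then cyclic_reduction (butlast (tl w)) else w)"
  by auto
termination
  by (relation "measure length") auto

declare cyclic_reduction.simps [simp del]

definition primitivity_blocking :: "nat \<Rightarrow> nat letter list \<Rightarrow> bool" where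
  "primitivity_blocking r v \<longleftrightarrow>
     v \<in> carrier (F r) \<and>
     (\<forall>\<phi> \<in> auto (F r). \<not> sublist v (cyclic_reduction (\<phi> (gen 1))))"

end

theory Submission
  imports Defs
begin

text \<open>Enlarge the given proper subset to \<open>B - {b}\<close> and let \<open>H\<close> be the subgroup it generates. For
  every \<open>p \<in> H\<close> the element \<open>bp\<close> is primitive, as \<open>b\<close> may be replaced by \<open>bp\<close> in \<open>B\<close>. Since
  \<open>H\<close> has rank \<open>r - 1 \<ge> 2\<close> and contains words with different first letters, it contains words
  avoiding any prescribed first and any prescribed last letter. Hence \<open>p\<close> can be chosen so that
  \<open>bp\<close> is cyclically reduced as written; and a given \<open>u \<in> H\<close> can be padded to a reduced
  product \<open>p = huk\<close> with this property. So every \<open>u \<in> B\<close> is a subword of a cyclically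
  reduced primitive word.\<close>

section \<open>Homomorphisms from free groups\<close>

text \<open>The homomorphism out of a free group that extends an assignment \<open>f\<close> of
  group elements to the generators. Relabelling the letters reduces it to \<open>word_value\<close>,
  whose letters have to be group elements themselves.\<close>

definition subst_value :: "('g, 'm) monoid_scheme \<Rightarrow> ('a \<Rightarrow> 'g) \<Rightarrow> 'a letter list \<Rightarrow> 'g" where
  "subst_value G f w = word_value G (map (apfst f) w)"

lemma subst_value_Nil [simp]: "subst_value G f [] = \<one>\<^bsub>G\<^esub>"
  by (simp add: subst_value_def)

lemma subst_value_Cons [simp]:
  "subst_value G f ((x, s) # w) = (if s then f x else inv\<^bsub>G\<^esub> f x) \<otimes>\<^bsub>G\<^esub> subst_value G f w"
  by (simp add: subst_value_def)

lemma word_value_conv_subst_value: "word_value G = subst_value G (\<lambda>x. x)"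
proof -
  have "apfst (\<lambda>x. x) = (\<lambda>l::'a letter. l)"
    by (auto simp: fun_eq_iff)
  then show ?thesis
    unfolding subst_value_def by simp
qed

lemma (in group) subst_value_closed [simp]:
  "f ` fst ` set w \<subseteq> carrier G \<Longrightarrow> subst_value G f w \<in> carrier G"
  by (induction w) auto

lemma (in group) subst_value_append:
  assumes "f ` fst ` set u \<subseteq> carrier G" "f ` fst ` set v \<subseteq> carrier G"
  shows "subst_value G f (u @ v) = subst_value G f u \<otimes> subst_value G f v"
  using assms by (induction u) (auto simp: m_assoc)

lemma (in group) subst_value_cons_reduce:
  assumes "f ` fst ` set (a # w) \<subseteq> carrier G"
  shows "subst_value G f (cons_reduce a w) = subst_value G f (a # w)"
proof (cases "\<exists>w'. w = inv_letter a # w'")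
  case True
  then obtain w' where w: "w = inv_letter a # w'"
    by blast
  obtain x s where a: "a = (x, s)"
    by fastforce
  have "f x \<in> carrier G" "subst_value G f w' \<in> carrier G"
    using assms w a by auto
  then show ?thesis
    using a w by (auto simp: inv_letter_def m_assoc[symmetric])
next
  case False
  then show ?thesis
    by (cases w) auto
qed

lemma set_free_reduction: "set (free_reduction w) \<subseteq> set w"
  using set_foldr_cons_reduce[of w "[]"] by (simp add: free_reduction_def)

text \<open>Free reduction only removes adjacent inverse pairs, and these contribute the identity.
  This makes evaluation multiplicative for the reduced product.\<close>

lemma (in group) subst_value_free_reduction:
  "f ` fst ` set w \<subseteq> carrier G \<Longrightarrow> subst_value G f (free_reduction w) = subst_value G f w"
proof (induction w)
  case (Cons a w)
  obtain x s where a: "a = (x, s)"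
    by fastforce
  have "f ` fst ` set (a # free_reduction w) \<subseteq> carrier G"
    using Cons.prems set_free_reduction[of w] by auto
  from subst_value_cons_reduce[OF this] Cons show ?case
    by (auto simp: a free_reduction_def)
qed (simp add: free_reduction_def)

section \<open>Products and inverses of reduced words\<close>

lemma mult_free_group [simp]: "u \<otimes>\<^bsub>free_group S\<^esub> v = free_reduction (u @ v)"
  by (simp add: free_group_def)

lemma one_free_group [simp]: "\<one>\<^bsub>free_group S\<^esub> = []"
  by (simp add: free_group_def)

lemma carrier_free_group: "w \<in> carrier (free_group S) \<longleftrightarrow> reduced w \<and> fst ` set w \<subseteq> S"
  by (simp add: free_group_def)

lemma gen_carrier [simp]: "[(x, s)] \<in> carrier (free_group S) \<longleftrightarrow> x \<in> S"
  by (auto simp: carrier_free_group reduced_def)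

definition inverse_word :: "'a letter list \<Rightarrow> 'a letter list" where
  "inverse_word w = map inv_letter (rev w)"

lemma inverse_word_simps [simp]:
  "inverse_word [] = []"
  "inverse_word (u @ v) = inverse_word v @ inverse_word u"
  "inverse_word (inverse_word w) = w"
  "length (inverse_word w) = length w"
  "inverse_word w = [] \<longleftrightarrow> w = []"
  "fst ` set (inverse_word w) = fst ` set w"
  by (simp_all add: inverse_word_def rev_map comp_def image_image)

lemma hd_inverse_word: "w \<noteq> [] \<Longrightarrow> hd (inverse_word w) = inv_letter (last w)"
  by (simp add: inverse_word_def hd_map hd_rev)

lemma last_inverse_word: "w \<noteq> [] \<Longrightarrow> last (inverse_word w) = inv_letter (hd w)"
  by (simp add: inverse_word_def last_map last_rev)

lemma reduced_inverse_word [simp]: "reduced (inverse_word w) \<longleftrightarrow> reduced w"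
  using reduced_inverse[of w] reduced_inverse[of "inverse_word w"]
  by (auto simp: inverse_word_def rev_map comp_def)

lemma inv_free_group:
  assumes "u \<in> carrier (free_group S)"
  shows "inv\<^bsub>free_group S\<^esub> u = inverse_word u"
proof -
  interpret group "free_group S"
    by (rule group_free_group)
  have "inverse_word u \<in> carrier (free_group S)"
    using assms by (simp add: carrier_free_group)
  moreover have "inverse_word u \<otimes>\<^bsub>free_group S\<^esub> u = \<one>\<^bsub>free_group S\<^esub>"
    using foldr_inverse[of u] by (simp add: free_reduction_def inverse_word_def)
  ultimately show ?thesis
    using assms inv_equality by blast
qed

section \<open>Universal property of the free group\<close>

lemma (in group) subst_value_hom:
  assumes "f ` S \<subseteq> carrier G"
  shows "subst_value G f \<in> hom (free_group S) G"
proof (rule homI)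
  fix u v assume "u \<in> carrier (free_group S)" "v \<in> carrier (free_group S)"
  then have u: "f ` fst ` set u \<subseteq> carrier G" and v: "f ` fst ` set v \<subseteq> carrier G"
    using assms unfolding carrier_free_group by blast+
  then show "subst_value G f u \<in> carrier G"
    by simp
  have "f ` fst ` set (u @ v) \<subseteq> carrier G"
    using u v by (simp only: set_append image_Un Un_subset_iff)
  then show "subst_value G f (u \<otimes>\<^bsub>free_group S\<^esub> v) = subst_value G f u \<otimes> subst_value G f v"
    by (simp add: subst_value_free_reduction subst_value_append[OF u v])
qed

text \<open>Uniqueness in the universal property. The head of a reduced word splits off as a factor
  without cancellation, and \<open>h\<close> respects inverses of generators, so induction on the
  word applies.\<close>

lemma hom_free_group_eq_subst_value:
  assumes "group G" and h: "h \<in> hom (free_group S) G" and w: "w \<in> carrier (free_group S)"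
  shows "h w = subst_value G (\<lambda>x. h [(x, True)]) w"
  using w
proof (induction w)
  case Nil
  then show ?case
    using hom_one[OF h group_free_group assms(1)] by simp
next
  case (Cons a w)
  obtain x s where a: "a = (x, s)"
    by fastforce
  have w: "w \<in> carrier (free_group S)" and x: "x \<in> S"
    using Cons.prems a by (auto simp: carrier_free_group dest: reduced_ConsD)
  have "[(x, s)] \<otimes>\<^bsub>free_group S\<^esub> w = a # w"
    using Cons.prems a by (simp add: carrier_free_group free_reduction_reduced)
  then have "h (a # w) = h [(x, s)] \<otimes>\<^bsub>G\<^esub> h w"
    using hom_mult[OF h, of "[(x, s)]" w] w x by simp
  moreover have "h [(x, False)] = inv\<^bsub>G\<^esub> h [(x, True)]"
  proof -
    interpret group_hom "free_group S" G h
      using h assms(1) by (simp add: group_hom_def group_hom_axioms_def group_free_group)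
    show ?thesis
      using hom_inv[of "[(x, True)]"] x
      by (simp add: inv_free_group) (simp add: inverse_word_def inv_letter_def)
  qed
  ultimately show ?case
    using Cons.IH[OF w] a by (cases s) auto
qed

lemma hom_free_group_eqI:
  assumes "group G" "h \<in> hom (free_group S) G" "k \<in> hom (free_group S) G"
    and "\<And>x. x \<in> S \<Longrightarrow> h [(x, True)] = k [(x, True)]"
    and "w \<in> carrier (free_group S)"
  shows "h w = k w"
proof -
  have "map (apfst (\<lambda>x. h [(x, True)])) w = map (apfst (\<lambda>x. k [(x, True)])) w"
    using assms(4,5) by (auto simp: carrier_free_group)
  then show ?thesis
    unfolding hom_free_group_eq_subst_value[OF assms(1,2,5)]
      hom_free_group_eq_subst_value[OF assms(1,3,5)] subst_value_def by (rule arg_cong)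
qed

lemma (in group) subst_value_gen [simp]: "f x \<in> carrier G \<Longrightarrow> subst_value G f [(x, True)] = f x"
  by simp

text \<open>The composites \<open>k \<circ> h\<close> and \<open>h \<circ> k\<close> are
  homomorphisms that agree with the identity on generators, hence on the whole carrier.\<close>

lemma iso_free_groupI:
  assumes h: "h \<in> hom (free_group S) (free_group T)" and k: "k \<in> hom (free_group T) (free_group S)"
    and kh: "\<And>x. x \<in> S \<Longrightarrow> k (h [(x, True)]) = [(x, True)]"
    and hk: "\<And>y. y \<in> T \<Longrightarrow> h (k [(y, True)]) = [(y, True)]"
  shows "h \<in> iso (free_group S) (free_group T)"
proof (rule isoI[OF h])
  have "(k \<circ> h) w = id w" if "w \<in> carrier (free_group S)" for w
    by (rule hom_free_group_eqI[OF group_free_group Group.hom_compose[OF h k] _ _ that])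
      (use kh in \<open>auto simp: hom_def\<close>)
  moreover have "(h \<circ> k) w = id w" if "w \<in> carrier (free_group T)" for w
    by (rule hom_free_group_eqI[OF group_free_group Group.hom_compose[OF k h] _ _ that])
      (use hk in \<open>auto simp: hom_def\<close>)
  ultimately show "bij_betw h (carrier (free_group S)) (carrier (free_group T))"
    using h k by (intro bij_betw_byWitness[where f' = k]) (auto simp: hom_def)
qed

text \<open>A homomorphism onto \<open>free_group T\<close> makes precomposition injective on homomorphisms
  to \<open>\<int>/2\<close>; these correspond to the subsets of the generating set.\<close>

lemma card_le_of_surj_hom:
  assumes "finite S" and h: "h \<in> hom (free_group S) (free_group T)"
    and surj: "h ` carrier (free_group S) = carrier (free_group T)"
  shows "finite T \<and> card T \<le> card S"
proof -
  \<comment> \<open>This is \<int>/2 with exclusive or as addition, so \<open>par C\<close> gives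
    the parity of the number of letters whose generator lies in \<open>C\<close>.\<close>
  define Z where "Z = \<lparr>carrier = UNIV :: bool set, monoid.mult = (\<noteq>), one = False\<rparr>"
  interpret Z: group Z
    by (rule groupI) (auto simp: Z_def)
  define par where "par C = subst_value Z (\<lambda>x. x \<in> C)" for C :: "'b set"
  have par_hom: "par C \<in> hom (free_group T) Z" for C
    unfolding par_def by (rule Z.subst_value_hom) (auto simp: Z_def)
  have par_gen: "par C [(x, True)] \<longleftrightarrow> x \<in> C" for C x
    unfolding par_def by (subst Z.subst_value_gen) (auto simp: Z_def)
  \<comment> \<open>A homomorphism \<open>par C \<circ> h\<close> is determined by its values on
    generators, and \<open>g C\<close> records exactly these values.\<close>
  define g where "g C = {x \<in> S. par C (h [(x, True)])}" for C
  have inj: "inj_on g (Pow T)"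
  proof (rule inj_onI)
    fix C D assume C: "C \<in> Pow T" and D: "D \<in> Pow T" and eq: "g C = g D"
    have "(par C \<circ> h) w = (par D \<circ> h) w" if "w \<in> carrier (free_group S)" for w
      by (rule hom_free_group_eqI[OF Z.group_axioms Group.hom_compose[OF h par_hom]
            Group.hom_compose[OF h par_hom] _ that])
        (use eq in \<open>auto simp: g_def\<close>)
    then have "par C v = par D v" if "v \<in> carrier (free_group T)" for v
      using that surj by (metis (no_types, lifting) comp_apply imageE)
    then have "x \<in> C \<longleftrightarrow> x \<in> D" if "x \<in> T" for x
      using that par_gen by (metis gen_carrier)
    then show "C = D"
      using C D by blast
  qed
  have sub: "g ` Pow T \<subseteq> Pow S"
    by (auto simp: g_def)
  have "finite (Pow T)"
    using inj sub assms(1) by (metis finite_Pow_iff inj_on_finite)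
  then have T: "finite T"
    by simp
  have "card (Pow T) \<le> card (Pow S)"
    using inj sub assms(1) by (simp add: card_inj_on_le)
  then show ?thesis
    using T assms(1) by (simp add: card_Pow)
qed

section \<open>Words over a basis\<close>

text \<open>The image of a homomorphism is a subgroup, and this one contains \<open>A\<close>;
  conversely every letter evaluates to an element of \<open>A\<close> or the inverse of one.\<close>

lemma (in group) generate_eq_word_value_image:
  assumes "A \<subseteq> carrier G"
  shows "generate G A = word_value G ` carrier (free_group A)"
proof
  interpret h: group_hom "free_group A" G "word_value G"
    using subst_value_hom[of "\<lambda>x. x" A] assms is_group
    by (simp add: group_hom_def group_hom_axioms_def group_free_group word_value_conv_subst_value)
  have "A \<subseteq> word_value G ` carrier (free_group A)"
  proof
    fix x assume "x \<in> A"
    then have "x = word_value G [(x, True)]" "[(x, True)] \<in> carrier (free_group A)"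
      using assms by auto
    then show "x \<in> word_value G ` carrier (free_group A)"
      by blast
  qed
  then show "generate G A \<subseteq> word_value G ` carrier (free_group A)"
    by (rule generate_subgroup_incl) (rule h.img_is_subgroup)
  have "word_value G w \<in> generate G A" if "fst ` set w \<subseteq> A" for w
    using that
  proof (induction w)
    case Nil
    show ?case
      by (simp add: generate.one)
  next
    case (Cons l w)
    obtain x s where l: "l = (x, s)"
      by fastforce
    have "(if s then x else inv x) \<in> generate G A"
      using Cons.prems l by (simp add: generate.incl generate.inv)
    moreover have "word_value G w \<in> generate G A"
      using Cons by simp
    ultimately show ?case
      unfolding l word_value.simps by (rule generate.eng)
  qed
  then show "word_value G ` carrier (free_group A) \<subseteq> generate G A"
    by (auto simp: carrier_free_group)
qed

text \<open>Freeness of \<open>B\<close> says that evaluation has trivial kernel, and generation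
  says that it is onto.\<close>

lemma (in group) word_value_iso:
  assumes "free_generating_set G B"
  shows "word_value G \<in> iso (free_group B) G"
proof -
  have B: "B \<subseteq> carrier G" and gen: "generate G B = carrier G"
    using assms by (auto simp: free_generating_set_def)
  interpret h: group_hom "free_group B" G "word_value G"
    using subst_value_hom[of "\<lambda>x. x" B] B is_group
    by (simp add: group_hom_def group_hom_axioms_def group_free_group word_value_conv_subst_value)
  have "inj_on (word_value G) (carrier (free_group B))"
    using assms by (intro h.inj_on_one_iff[THEN iffD2])
      (auto simp: carrier_free_group free_generating_set_def)
  then show ?thesis
    using generate_eq_word_value_image[OF B] gen
    by (intro isoI h.homh) (simp add: bij_betw_def)
qed

text \<open>Invariance of rank: the bound for surjections is applied to evaluation and to its
  inverse. The map out of \<open>F r\<close> comes first, because the bound asks for finitely many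
  generators at the source and then yields that \<open>B\<close> is finite.\<close>

lemma card_basis:
  assumes "basis r B"
  shows "finite B \<and> card B = r"
proof -
  interpret group "F r"
    by (rule group_free_group)
  have iso: "word_value (F r) \<in> iso (free_group B) (F r)"
    using assms word_value_iso by (simp add: basis_def)
  have iso': "inv_into (carrier (free_group B)) (word_value (F r)) \<in> iso (F r) (free_group B)"
    using group.iso_set_sym[OF group_free_group iso] .
  have "finite B \<and> card B \<le> card {1..r}"
    using iso' by (intro card_le_of_surj_hom) (auto simp: iso_def bij_betw_def)
  moreover from this have "card {1..r} \<le> card B"
    using card_le_of_surj_hom[of B "word_value (F r)" "{1..r}"] iso
    by (auto simp: iso_def bij_betw_def)
  ultimately show ?thesis
    by simp
qed

section \<open>Automorphisms adapted to a basis\<close>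

text \<open>The substitution \<open>b \<mapsto> bq\<close> is undone by
  \<open>b \<mapsto> bq\<inverse>\<close>, because \<open>q\<close> does not involve
  \<open>b\<close> and is fixed by both.\<close>

lemma transvection_iso:
  assumes "b \<in> B" and q: "q \<in> carrier (free_group (B - {b}))"
  defines "f p \<equiv> \<lambda>x. if x = b then [(b, True)] \<otimes>\<^bsub>free_group B\<^esub> p else [(x, True)]"
  shows "subst_value (free_group B) (f q) \<in> iso (free_group B) (free_group B)"
proof -
  let ?G = "free_group B"
  interpret group ?G
    by (rule group_free_group)
  have sub: "w \<in> carrier ?G" if "w \<in> carrier (free_group (B - {b}))" for w
    using that by (auto simp: carrier_free_group)
  have f: "f p ` B \<subseteq> carrier ?G" if "p \<in> carrier (free_group (B - {b}))" for p
    using m_closed[OF _ sub[OF that], of "[(b, True)]"] assms(1) by (auto simp: f_def)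
  have h: "subst_value ?G (f p) \<in> hom ?G ?G" if "p \<in> carrier (free_group (B - {b}))" for p
    by (rule subst_value_hom[OF f[OF that]])
  have fixed: "subst_value ?G (f p) w = w"
    if p: "p \<in> carrier (free_group (B - {b}))" and w: "w \<in> carrier (free_group (B - {b}))" for p w
  proof -
    have "subst_value ?G (f p) \<in> hom (free_group (B - {b})) ?G" "id \<in> hom (free_group (B - {b})) ?G"
      using h[OF p] sub by (auto simp: hom_def)
    moreover have "subst_value ?G (f p) [(x, True)] = id [(x, True)]" if "x \<in> B - {b}" for x
      using that by (simp add: f_def free_reduction_def)
    ultimately have "subst_value ?G (f p) w = id w"
      using w hom_free_group_eqI[OF is_group] by blast
    then show ?thesis by simp
  qed
  \<comment> \<open>Stated for any \<open>p\<close>, \<open>p'\<close> with trivial product, so that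
    it serves both orders of composition. On \<open>b\<close> the result is \<open>(bp)p'\<close>,
    as the outer substitution fixes \<open>p'\<close>.\<close>
  have canc: "subst_value ?G (f p) (subst_value ?G (f p') [(x, True)]) = [(x, True)]"
    if p: "p \<in> carrier (free_group (B - {b}))" and p': "p' \<in> carrier (free_group (B - {b}))"
      and x: "x \<in> B" and pp': "p \<otimes>\<^bsub>?G\<^esub> p' = \<one>\<^bsub>?G\<^esub>" for p p' x
  proof (cases "x = b")
    case True
    have b: "[(b, True)] \<in> carrier ?G"
      using assms(1) by simp
    have gen: "subst_value ?G (f p'') [(x, True)] = [(b, True)] \<otimes>\<^bsub>?G\<^esub> p''"
      if "p'' \<in> carrier (free_group (B - {b}))" for p''
      using subst_value_gen[of "f p''" x] f[OF that] x True by (auto simp: f_def)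
    have "subst_value ?G (f p) (subst_value ?G (f p') [(x, True)])
        = subst_value ?G (f p) [(b, True)] \<otimes>\<^bsub>?G\<^esub> subst_value ?G (f p) p'"
      using gen[OF p'] hom_mult[OF h[OF p] b sub[OF p']] by argo
    also have "\<dots> = [(b, True)] \<otimes>\<^bsub>?G\<^esub> p \<otimes>\<^bsub>?G\<^esub> p'"
      using gen[OF p] fixed[OF p p'] True by argo
    also have "\<dots> = [(b, True)] \<otimes>\<^bsub>?G\<^esub> (p \<otimes>\<^bsub>?G\<^esub> p')"
      by (rule m_assoc[OF b sub[OF p] sub[OF p']])
    also have "\<dots> = [(x, True)]"
      unfolding pp' using True b by (simp only: r_one)
    finally show ?thesis .
  next
    case False
    then show ?thesis
      using fixed[OF p, of "[(x, True)]"] fixed[OF p', of "[(x, True)]"] x by simp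
  qed
  have q': "inverse_word q \<in> carrier (free_group (B - {b}))"
    using q by (simp add: carrier_free_group)
  have "q \<otimes>\<^bsub>?G\<^esub> inverse_word q = \<one>\<^bsub>?G\<^esub>" "inverse_word q \<otimes>\<^bsub>?G\<^esub> q = \<one>\<^bsub>?G\<^esub>"
    using sub[OF q] r_inv[of q] l_inv[of q] by (simp_all only: inv_free_group)
  then show ?thesis
    using canc q q' by (intro iso_free_groupI[OF h[OF q] h[OF q']]) blast+
qed

lemma relabel_iso:
  assumes "bij_betw f S T"
  shows "subst_value (free_group T) (\<lambda>x. [(f x, True)]) \<in> iso (free_group S) (free_group T)"
proof (rule iso_free_groupI)
  interpret S: group "free_group S"
    by (rule group_free_group)
  interpret T: group "free_group T"
    by (rule group_free_group)
  let ?g = "inv_into S f"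
  have f: "f x \<in> T" if "x \<in> S" for x
    using that assms by (auto simp: bij_betw_def)
  have g: "?g y \<in> S" if "y \<in> T" for y
    using that assms by (metis bij_betw_def inv_into_into)
  show "subst_value (free_group T) (\<lambda>x. [(f x, True)]) \<in> hom (free_group S) (free_group T)"
    using f by (intro T.subst_value_hom) auto
  show "subst_value (free_group S) (\<lambda>x. [(?g x, True)]) \<in> hom (free_group T) (free_group S)"
    using g by (intro S.subst_value_hom) auto
  show "subst_value (free_group S) (\<lambda>x. [(?g x, True)])
      (subst_value (free_group T) (\<lambda>x. [(f x, True)]) [(x, True)]) = [(x, True)]" if "x \<in> S" for x
    using that assms by (simp add: free_reduction_def bij_betw_def)
  show "subst_value (free_group T) (\<lambda>x. [(f x, True)])
      (subst_value (free_group S) (\<lambda>x. [(?g x, True)]) [(x, True)]) = [(x, True)]" if "x \<in> T" for x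
    using that assms by (simp add: free_reduction_def bij_betw_def f_inv_into_f)
qed

text \<open>The automorphism is a composite: send the first generator to the formal letter
  \<open>b\<close>, multiply that letter by a word \<open>q\<close> representing \<open>p\<close>,
  then evaluate in \<open>F r\<close>.\<close>

lemma primitive_basis_mult:
  assumes "basis r B" "b \<in> B" "p \<in> generate (F r) (B - {b})"
  shows "\<exists>\<phi> \<in> auto (F r). \<phi> (gen 1) = b \<otimes>\<^bsub>F r\<^esub> p"
proof -
  interpret group "F r"
    by (rule group_free_group)
  have B: "B \<subseteq> carrier (F r)"
    using assms(1) by (simp add: basis_def free_generating_set_def)
  have "B - {b} \<subseteq> carrier (F r)"
    using B by blast
  from generate_eq_word_value_image[OF this] assms(3)
  obtain q where q: "q \<in> carrier (free_group (B - {b}))" "p = word_value (F r) q"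
    by blast
  then have qB: "q \<in> carrier (free_group B)"
    by (auto simp: carrier_free_group)
  obtain \<sigma>0 where \<sigma>0: "bij_betw \<sigma>0 {1..r} B"
    using card_basis[OF assms(1)] by (metis card_atLeastAtMost diff_Suc_1 finite_atLeastAtMost
        finite_same_card_bij)
  have r: "1 \<in> {1..r}"
    using \<sigma>0 assms(2) by (fastforce simp: bij_betw_def)
  obtain j where j: "j \<in> {1..r}" "\<sigma>0 j = b"
    using \<sigma>0 assms(2) by (auto simp: bij_betw_def)
  \<comment> \<open>The transposition makes the enumeration of \<open>B\<close> start with
    \<open>b\<close>.\<close>
  define \<sigma> where "\<sigma> = \<sigma>0 \<circ> transpose 1 j"
  have "bij_betw (transpose 1 j) {1..r} {1..r}"
    using r j(1) by simp
  then have \<sigma>: "bij_betw \<sigma> {1..r} B" "\<sigma> 1 = b"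
    using \<sigma>0 j(2) by (auto simp only: \<sigma>_def bij_betw_trans comp_apply transpose_apply_first)
  define \<rho> where "\<rho> = subst_value (free_group B) (\<lambda>x. [(\<sigma> x, True)])"
  define \<tau> where "\<tau> = subst_value (free_group B)
    (\<lambda>x. if x = b then [(b, True)] \<otimes>\<^bsub>free_group B\<^esub> q else [(x, True)])"
  have \<rho>: "\<rho> \<in> iso (F r) (free_group B)"
    unfolding \<rho>_def by (rule relabel_iso[OF \<sigma>(1)])
  have \<tau>: "\<tau> \<in> iso (free_group B) (free_group B)"
    unfolding \<tau>_def by (rule transvection_iso[OF assms(2) q(1)])
  have \<Phi>: "word_value (F r) \<in> iso (free_group B) (F r)"
    using assms(1) word_value_iso by (simp add: basis_def)
  define \<psi> where "\<psi> = word_value (F r) \<circ> (\<tau> \<circ> \<rho>)"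
  have \<psi>: "\<psi> \<in> iso (F r) (F r)"
    unfolding \<psi>_def by (intro iso_set_trans[OF _ \<Phi>] iso_set_trans[OF \<rho> \<tau>])
  have bB: "[(b, True)] \<in> carrier (free_group B)"
    using assms(2) by simp
  have "\<rho> (gen 1) = [(b, True)]"
    using \<sigma> by (simp add: \<rho>_def free_reduction_def)
  moreover have "\<tau> [(b, True)] = [(b, True)] \<otimes>\<^bsub>free_group B\<^esub> q"
    unfolding \<tau>_def using monoid.m_closed[OF group.is_monoid[OF group_free_group] bB qB]
    by (subst group.subst_value_gen[OF group_free_group]) auto
  moreover have "word_value (F r) ([(b, True)] \<otimes>\<^bsub>free_group B\<^esub> q) = b \<otimes>\<^bsub>F r\<^esub> p"
    using hom_mult[OF _ bB qB, of "word_value (F r)" "F r"] \<Phi> q(2) assms(2) B r_one[of b]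
    by (auto simp: iso_def simp del: r_one)
  ultimately have "\<psi> (gen 1) = b \<otimes>\<^bsub>F r\<^esub> p"
    by (simp add: \<psi>_def)
  moreover have g1: "gen 1 \<in> carrier (F r)"
    using r by simp
  \<comment> \<open>Members of \<open>auto\<close> are \<open>undefined\<close> off the carrier, so
    \<open>\<psi>\<close> itself need not be one.\<close>
  moreover have "restrict \<psi> (carrier (F r)) \<in> auto (F r)"
  proof -
    have "bij_betw (restrict \<psi> (carrier (F r))) (carrier (F r)) (carrier (F r))"
      using \<psi> unfolding iso_def by (subst bij_betw_cong[of _ _ \<psi>]) auto
    moreover have "restrict \<psi> (carrier (F r)) \<in> hom (F r) (F r)"
      using \<psi> m_closed by (auto simp: iso_def hom_def Pi_iff simp del: mult_free_group)
    ultimately show ?thesis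
      by (simp add: auto_def Bij_def)
  qed
  ultimately show ?thesis
    by (metis restrict_apply')
qed

section \<open>Reduced concatenations and non-commuting elements\<close>

lemma reduced_append:
  "reduced (u @ v) \<longleftrightarrow> reduced u \<and> reduced v \<and> (u \<noteq> [] \<and> v \<noteq> [] \<longrightarrow> hd v \<noteq> inv_letter (last u))"
  by (auto simp: reduced_def successively_append_iff)

lemma reduced_Cons:
  "reduced (a # w) \<longleftrightarrow> reduced w \<and> (w \<noteq> [] \<longrightarrow> hd w \<noteq> inv_letter a)"
  by (auto simp: reduced_def successively_Cons)

text \<open>Let the reduced word \<open>W\<close> over \<open>A\<close> represent \<open>w\<close>,
  and let \<open>z\<close> be an element of \<open>A\<close> other than the generator in its first
  letter. Then \<open>zW\<close> is reduced and begins with \<open>z\<close>, whereas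
  \<open>Wz\<close> reduces to a word that is shorter than \<open>W\<close> or begins like
  \<open>W\<close>.\<close>

lemma generate_not_commuting:
  assumes "basis r B" and A: "A \<subseteq> B" and xy: "x \<in> A" "y \<in> A" "x \<noteq> y"
    and w: "w \<in> generate (F r) A" "w \<noteq> []"
  shows "\<exists>z \<in> generate (F r) A. z \<otimes>\<^bsub>F r\<^esub> w \<noteq> w \<otimes>\<^bsub>F r\<^esub> z"
proof -
  interpret group "F r"
    by (rule group_free_group)
  interpret B: group "free_group B"
    by (rule group_free_group)
  have B: "B \<subseteq> carrier (F r)"
    using assms(1) by (simp add: basis_def free_generating_set_def)
  have "A \<subseteq> carrier (F r)"
    using B A by blast
  from generate_eq_word_value_image[OF this] w(1)
  obtain W where W: "W \<in> carrier (free_group A)" "w = word_value (F r) W"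
    by blast
  have WB: "W \<in> carrier (free_group B)"
    using W(1) A by (auto simp: carrier_free_group)
  have "W \<noteq> []"
    using W(2) w(2) by auto
  obtain z where z: "z \<in> A" "z \<noteq> fst (hd W)"
    using xy by metis
  let ?z = "[(z, True)]"
  have zB: "?z \<in> carrier (free_group B)"
    using z A by auto
  have \<Phi>: "word_value (F r) \<in> iso (free_group B) (F r)"
    using assms(1) word_value_iso by (simp add: basis_def)
  then have hom: "word_value (F r) \<in> hom (free_group B) (F r)"
    and inj: "inj_on (word_value (F r)) (carrier (free_group B))"
    by (auto simp: iso_def bij_betw_def)
  have z_val: "word_value (F r) ?z = z"
    using B A z r_one[of z] by (auto simp del: mult_free_group)
  have "z \<otimes>\<^bsub>F r\<^esub> w \<noteq> w \<otimes>\<^bsub>F r\<^esub> z"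
  proof
    assume "z \<otimes>\<^bsub>F r\<^esub> w = w \<otimes>\<^bsub>F r\<^esub> z"
    then have "word_value (F r) (?z \<otimes>\<^bsub>free_group B\<^esub> W) = word_value (F r) (W \<otimes>\<^bsub>free_group B\<^esub> ?z)"
      using hom_mult[OF hom zB WB] hom_mult[OF hom WB zB] z_val W(2) by argo
    then have eq: "?z \<otimes>\<^bsub>free_group B\<^esub> W = W \<otimes>\<^bsub>free_group B\<^esub> ?z"
      using inj_onD[OF inj] B.m_closed[OF zB WB] B.m_closed[OF WB zB] by blast
    have redW: "reduced W"
      using W(1) by (simp add: carrier_free_group)
    have "reduced (?z @ W)"
      using redW z(2) by (auto simp: reduced_Cons inv_letter_def)
    then have 1: "?z \<otimes>\<^bsub>free_group B\<^esub> W = (z, True) # W"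
      by (simp add: free_reduction_reduced)
    show False
    proof (cases "last W = (z, False)")
      case True
      then obtain W' where W': "W = W' @ [(z, False)]"
        using \<open>W \<noteq> []\<close> by (metis append_butlast_last_id)
      have "reduced W'"
        using redW W' by (simp add: reduced_append)
      then have "W \<otimes>\<^bsub>free_group B\<^esub> ?z = W'"
        using free_reduction_reduced[of W'] by (simp add: W' free_reduction_def inv_letter_def)
      then show False
        using arg_cong[OF eq, of length] unfolding 1 by (simp add: W' del: mult_free_group)
    next
      case False
      then have "reduced (W @ ?z)"
        using redW by (auto simp: reduced_append reduced_Cons inv_letter_def prod_eq_iff)
      then have "W \<otimes>\<^bsub>free_group B\<^esub> ?z = W @ ?z"
        by (simp add: free_reduction_reduced)
      then show False
        using eq 1 z(2) \<open>W \<noteq> []\<close> by (cases W) auto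
    qed
  qed
  then show ?thesis
    using z(1) by (blast intro: generate.incl)
qed

section \<open>First and last letters in subgroups\<close>

text \<open>Here \<open>s\<close> is the part of \<open>u\<close> that cancels against the start of
  \<open>v\<close>. Induction from the right end of \<open>u\<close> meets the cancelling pairs in
  order, and the first pair that does not cancel ends the process.\<close>

lemma cancellation_decomp:
  assumes "reduced u" "reduced v"
  obtains u' s v' where "u = u' @ s" "v = inverse_word s @ v'" "reduced (u' @ v')"
    "free_reduction (u @ v) = u' @ v'"
  using assms
proof (induction u arbitrary: v thesis rule: rev_induct)
  case Nil
  then show ?case
    by (metis append_Nil free_reduction_reduced inverse_word_simps(1))
next
  case (snoc a u)
  show ?case
  proof (cases "\<exists>v'. v = inv_letter a # v'")
    case True
    then obtain v1 where v: "v = inv_letter a # v1"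
      by blast
    have "reduced u" "reduced v1"
      using snoc.prems v by (auto simp: reduced_append dest: reduced_ConsD)
    with snoc.IH obtain u' s v' where d: "u = u' @ s" "v1 = inverse_word s @ v'" "reduced (u' @ v')"
      "free_reduction (u @ v1) = u' @ v'"
      by metis
    have "cons_reduce a v = v1"
      by (simp add: v)
    then have "free_reduction ((u @ [a]) @ v) = u' @ v'"
      using d(4) snoc.prems(3) \<open>reduced v1\<close> free_reduction_append[of v "u @ [a]"]
      by (simp add: free_reduction_append del: append_assoc)
    moreover have "u @ [a] = u' @ (s @ [a])" "v = inverse_word (s @ [a]) @ v'"
      using d v by (auto simp: inverse_word_def)
    ultimately show ?thesis
      using snoc.prems(1) d(3) by blast
  next
    case False
    have "reduced ((u @ [a]) @ v)"
      using snoc.prems False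
      by (subst reduced_append) (metis last_snoc list.collapse)
    then show ?thesis
      using snoc.prems(1)[of "u @ [a]" "[]" v] by (simp add: free_reduction_reduced)
  qed
qed

text \<open>If the easier choices all fail, then \<open>e = a\<inverse>\<close> and there are two non-commuting words
  \<open>h\<close>, \<open>q\<close> that both begin with a letter other than \<open>a\<close> and end with \<open>a\<inverse>\<close>. Then \<open>qh\<close> and \<open>hq\<close>
  are distinct reduced words of equal length, so neither is absorbed in the product
  \<open>qh(hq)\<inverse>\<close>, which begins like \<open>q\<close> and ends with the inverse of the first letter of \<open>h\<close>.\<close>

lemma subgroup_endpoints:
  assumes H: "subgroup H (free_group S)"
    and wv: "w \<in> H" "v \<in> H" "w \<noteq> []" "v \<noteq> []" "hd w \<noteq> hd v"
    and nc: "\<And>h. h \<in> H \<Longrightarrow> h \<noteq> [] \<Longrightarrow> \<exists>y \<in> H. y \<otimes>\<^bsub>free_group S\<^esub> h \<noteq> h \<otimes>\<^bsub>free_group S\<^esub> y"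
  shows "\<exists>p \<in> H. p \<noteq> [] \<and> hd p \<noteq> a \<and> last p \<noteq> e"
proof (rule ccontr)
  assume "\<not> ?thesis"
  then have no: "hd p = a \<or> last p = e" if "p \<in> H" "p \<noteq> []" for p
    using that by blast
  interpret group "free_group S"
    by (rule group_free_group)
  interpret H: subgroup H "free_group S"
    by (rule H)
  have car: "p \<in> carrier (free_group S)" if "p \<in> H" for p
    using that by (rule H.mem_carrier)
  have red: "reduced p" if "p \<in> H" for p
    using car[OF that] by (simp add: carrier_free_group)
  have inv: "inverse_word p \<in> H" if "p \<in> H" for p
    using H.m_inv_closed[OF that] inv_free_group[OF car[OF that]] by simp
  have app: "p @ q \<in> H" if "p \<in> H" "q \<in> H" "reduced (p @ q)" for p q
    using H.m_closed[OF that(1,2)] that(3) by (simp add: free_reduction_reduced)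
  \<comment> \<open>As \<open>w\<close> and \<open>v\<close> have different first letters, at least
    one of them avoids any given first letter.\<close>
  obtain h where h: "h \<in> H" "h \<noteq> []" "hd h \<noteq> a"
    using wv by metis
  then have last_h: "last h = e"
    using no by blast
  \<comment> \<open>Last letters are controlled through inverses: the inverse of \<open>z0\<close>
    does not end in \<open>e\<close>.\<close>
  obtain z0 where z0: "z0 \<in> H" "z0 \<noteq> []" "hd z0 \<noteq> inv_letter e"
    using wv by metis
  define z where "z = inverse_word z0"
  have z: "z \<in> H" "z \<noteq> []" "last z \<noteq> e"
    using z0 inv[OF z0(1)] last_inverse_word[OF z0(2)] inv_letter_inv_letter[of "hd z0"]
    by (auto simp only: z_def inverse_word_simps)
  then have hd_z: "hd z = a"
    using no by blast
  \<comment> \<open>Otherwise nothing cancels between the final \<open>e\<close> of \<open>h\<close>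
    and the initial \<open>a\<close> of \<open>z\<close>, and \<open>hz\<close> avoids both
    forbidden letters.\<close>
  have e: "e = inv_letter a"
  proof (rule ccontr)
    assume "e \<noteq> inv_letter a"
    then have "hd z \<noteq> inv_letter (last h)"
      unfolding hd_z last_h by (metis inv_letter_inv_letter)
    then have "reduced (h @ z)"
      using red[OF h(1)] red[OF z(1)] by (simp add: reduced_append)
    then have "h @ z \<in> H"
      using h z app by blast
    then show False
      using no[of "h @ z"] h z by simp
  qed
  have red_app: "reduced (p @ q)" if "p \<in> H" "q \<in> H" "q \<noteq> []" "hd q \<noteq> a" "p = [] \<or> last p = e" for p q
    using red[OF that(1)] red[OF that(2)] that(3-5) by (auto simp: reduced_append e)
  obtain y where y: "y \<in> H" "y \<otimes>\<^bsub>free_group S\<^esub> h \<noteq> h \<otimes>\<^bsub>free_group S\<^esub> y"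
    using nc h by blast
  \<comment> \<open>Powers of \<open>h\<close> serve as \<open>g\<close>. One longer than
    \<open>y\<close> is wanted, so that \<open>y\<close> cannot cancel all of it in
    \<open>q = gy\<close> and \<open>q\<close> still begins like \<open>h\<close>.\<close>
  have "\<exists>g \<in> H. length g \<ge> n \<and> g @ h = h @ g \<and> (g = [] \<or> hd g = hd h \<and> last g = e)" for n
  proof (induction n)
    case 0
    show ?case
      using H.one_closed by (intro bexI[of _ "[]"]) auto
  next
    case (Suc n)
    then obtain g where g: "g \<in> H" "length g \<ge> n" "g @ h = h @ g" "g = [] \<or> hd g = hd h \<and> last g = e"
      by blast
    have "g @ h \<in> H"
      using g h red_app app by blast
    moreover have "length (g @ h) \<ge> Suc n"
      using g(2) h(2) by (cases h) auto
    moreover have "(g @ h) @ h = h @ (g @ h)"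
      using g(3) by simp
    moreover have "hd (g @ h) = hd h \<and> last (g @ h) = e"
      using g(4) h(2) last_h by (auto simp: hd_append)
    ultimately show ?case
      by blast
  qed
  then obtain g where g: "g \<in> H" "length g \<ge> Suc (length y)" "g @ h = h @ g" "hd g = hd h"
    by (metis Suc_n_not_le_n le_trans list.size(3) not_less_eq_eq zero_le)
  define q where "q = g \<otimes>\<^bsub>free_group S\<^esub> y"
  have qH: "q \<in> H"
    unfolding q_def using g y by blast
  obtain g' s y' where d: "g = g' @ s" "y = inverse_word s @ y'" "free_reduction (g @ y) = g' @ y'"
    using cancellation_decomp[OF red[OF g(1)] red[OF y(1)]] by blast
  have "g' \<noteq> []"
    using d g(2) by auto
  then have q: "q \<noteq> []" "hd q = hd h"
    using d g(4) by (auto simp: q_def)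
  have last_q: "last q = e"
    using no[OF qH q(1)] q(2) h(3) by auto
  have redqh: "reduced (q @ h)" and redhq: "reduced (h @ q)"
    using red_app[OF qH h(1)] red_app[OF h(1) qH] h q last_h last_q by auto
  \<comment> \<open>Since \<open>g\<close> commutes with \<open>h\<close>, cancelling
    \<open>g\<close> would turn commutation of \<open>gy\<close> with \<open>h\<close> into
    commutation of \<open>y\<close> with \<open>h\<close>.\<close>
  have neq: "q @ h \<noteq> h @ q"
  proof
    assume "q @ h = h @ q"
    then have "q \<otimes>\<^bsub>free_group S\<^esub> h = h \<otimes>\<^bsub>free_group S\<^esub> q"
      by simp
    moreover have "g \<otimes>\<^bsub>free_group S\<^esub> h = h \<otimes>\<^bsub>free_group S\<^esub> g"
      using g(3) by simp
    ultimately have "g \<otimes>\<^bsub>free_group S\<^esub> (y \<otimes>\<^bsub>free_group S\<^esub> h) = g \<otimes>\<^bsub>free_group S\<^esub> (h \<otimes>\<^bsub>free_group S\<^esub> y)"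
      unfolding q_def using car g(1) h(1) y(1) by (metis m_assoc)
    then have "y \<otimes>\<^bsub>free_group S\<^esub> h = h \<otimes>\<^bsub>free_group S\<^esub> y"
      by (rule l_cancel) (use m_closed car g(1) h(1) y(1) in blast)+
    with y(2) show False
      by simp
  qed
  have qh: "q @ h \<in> H" and hq: "h @ q \<in> H"
    using app redqh redhq qH h(1) by blast+
  define k where "k = inverse_word (h @ q)"
  have k: "k \<in> H"
    unfolding k_def by (rule inv[OF hq])
  obtain u' t v' where d': "q @ h = u' @ t" "k = inverse_word t @ v'"
    "free_reduction ((q @ h) @ k) = u' @ v'"
    using cancellation_decomp[OF redqh red[OF k]] by blast
  have "h @ q = inverse_word (inverse_word t @ v')"
    using d'(2) by (metis inverse_word_simps(3) k_def)
  then have hq_eq: "h @ q = inverse_word v' @ t"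
    by simp
  \<comment> \<open>Removing the common end \<open>t\<close> from \<open>qh\<close> and
    \<open>hq\<close> leaves words of equal length, and not both are empty because \<open>qh\<close>
    and \<open>hq\<close> differ.\<close>
  have "length u' = length v'"
    using arg_cong[OF d'(1), of length] arg_cong[OF hq_eq, of length] by simp
  moreover have "u' \<noteq> [] \<or> v' \<noteq> []"
    using neq d'(1) hq_eq by auto
  ultimately have ne: "u' \<noteq> []" "v' \<noteq> []"
    by auto
  have "u' @ v' \<in> H"
    using H.m_closed[OF qh k] d'(3) by simp
  moreover have "hd (u' @ v') = hd h"
    using d'(1) ne q by (metis hd_append2)
  moreover have "inv_letter (last v') = hd h"
    using hq_eq ne h(2) hd_inverse_word[OF ne(2)] by (metis hd_append2 inverse_word_simps(5))
  then have "last (u' @ v') = inv_letter (hd h)"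
    using ne by (metis inv_letter_inv_letter last_appendR)
  ultimately show False
    using no[of "u' @ v'"] ne h(3) e by (metis append_is_Nil_conv inv_letter_inv_letter)
qed

section \<open>Padding a basis element to a cyclically reduced primitive word\<close>

theorem theorem3p7:
  fixes r :: nat and B :: "nat letter list set" and u :: "nat letter list"
  assumes "r \<ge> 3"
    and "basis r B"
    and "partially_reduced r B"
    and "u \<in> B"
  shows "\<not> (\<exists>v. sublist v u \<and> primitivity_blocking r v)"
proof
  assume "\<exists>v. sublist v u \<and> primitivity_blocking r v"
  then obtain v0 where v0: "sublist v0 u" "primitivity_blocking r v0"
    by blast
  interpret group "F r"
    by (rule group_free_group)
  have B: "B \<subseteq> carrier (F r)"
    using assms(2) by (simp add: basis_def free_generating_set_def)
  \<comment> \<open>If the empty word were in \<open>B\<close>, its one-letter formal word would be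
    a nontrivial relation.\<close>
  have nonempty: "x \<noteq> []" if "x \<in> B" for x
  proof -
    have "reduced [(x, True)]" "fst ` set [(x, True)] \<subseteq> B"
      using that by (auto simp: reduced_def)
    then have "word_value (F r) [(x, True)] \<noteq> \<one>\<^bsub>F r\<^esub>"
      using assms(2) unfolding basis_def free_generating_set_def by blast
    then show ?thesis
      by (auto simp: free_reduction_def)
  qed
  obtain Y w v where Y: "Y \<subset> B" "w \<in> generate (F r) Y" "v \<in> generate (F r) Y"
    and wv: "w \<noteq> []" "v \<noteq> []" "hd w \<noteq> hd v"
    using assms(3) unfolding partially_reduced_def by blast
  obtain b where b: "b \<in> B" "Y \<subseteq> B - {b}"
    using Y(1) by blast
  define H where "H = generate (F r) (B - {b})"
  \<comment> \<open>Since \<open>r \<ge> 3\<close>, two distinct basis elements remain besides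
    \<open>b\<close>; hence no nontrivial element of \<open>H\<close> commutes with all of
    \<open>H\<close>.\<close>
  have "finite B" "card B \<ge> 3"
    using card_basis[OF assms(2)] assms(1) by auto
  then have "card (B - {b}) \<ge> 2"
    using b(1) by simp
  then obtain C where "C \<subseteq> B - {b}" "card C = 2"
    by (metis obtain_subset_with_card_n)
  then obtain x y where xy: "x \<in> B - {b}" "y \<in> B - {b}" "x \<noteq> y"
    unfolding card_2_iff by blast
  have H: "subgroup H (F r)"
    unfolding H_def using B by (intro generate_is_subgroup) blast
  have "w \<in> H" "v \<in> H"
    using Y mono_generate[OF b(2)] by (auto simp: H_def)
  then have ends: "\<exists>p \<in> H. p \<noteq> [] \<and> hd p \<noteq> a \<and> last p \<noteq> e" for a e
    using generate_not_commuting[OF assms(2) Diff_subset xy] wv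
    by (intro subgroup_endpoints[OF H]) (auto simp: H_def)
  have red: "reduced p" if "p \<in> H \<or> p \<in> B" for p
    using that B subgroup.subset[OF H] carrier_free_group by blast
  \<comment> \<open>The condition on \<open>hd p\<close> makes \<open>bp\<close> reduced, the one on
    \<open>last p\<close> makes it cyclically reduced. Being primitive, it cannot contain
    \<open>v0\<close>, and so it cannot contain \<open>u\<close>.\<close>
  have not_sub: "\<not> sublist u (b @ p)"
    if p: "p \<in> H" "p \<noteq> []" "hd p \<noteq> inv_letter (last b)" "last p \<noteq> inv_letter (hd b)" for p
  proof
    assume "sublist u (b @ p)"
    have "reduced (b @ p)"
      using p red b(1) by (simp add: reduced_append)
    then obtain \<phi> where \<phi>: "\<phi> \<in> auto (F r)" "\<phi> (gen 1) = b @ p"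
      using primitive_basis_mult[OF assms(2) b(1), of p] p(1)
      by (auto simp: H_def free_reduction_reduced)
    have "cyclic_reduction (b @ p) = b @ p"
      using p nonempty[OF b(1)] by (subst cyclic_reduction.simps) simp
    then show False
      using \<phi> v0 \<open>sublist u (b @ p)\<close> unfolding primitivity_blocking_def
      by (metis sublist_order.order_trans)
  qed
  show False
  proof (cases "u = b")
    case True
    then show False
      using ends not_sub by (metis sublist_append_rightI)
  next
    case False
    then have u: "u \<in> H"
      using assms(4) by (auto simp: H_def intro: generate.incl)
    have "u \<noteq> []"
      using nonempty assms(4) by blast
    \<comment> \<open>The forbidden letters exclude cancellation at the joints of \<open>b\<close>,
      \<open>h\<close>, \<open>u\<close>, \<open>k\<close>, and also cyclically between the end of
      \<open>k\<close> and the start of \<open>b\<close>.\<close>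
    obtain h where h: "h \<in> H" "h \<noteq> []" "hd h \<noteq> inv_letter (last b)" "last h \<noteq> inv_letter (hd u)"
      using ends by blast
    obtain k where k: "k \<in> H" "k \<noteq> []" "hd k \<noteq> inv_letter (last u)" "last k \<noteq> inv_letter (hd b)"
      using ends by blast
    have hu: "reduced (h @ u)"
      using h u red \<open>u \<noteq> []\<close> by (auto simp: reduced_append)
    have huk: "reduced ((h @ u) @ k)"
      unfolding reduced_append[of "h @ u"] using hu k red \<open>u \<noteq> []\<close> by auto
    have "h @ u \<in> H"
      using subgroup.m_closed[OF H h(1) u] hu by (simp add: free_reduction_reduced)
    then have "(h @ u) @ k \<in> H"
      using subgroup.m_closed[OF H _ k(1)] huk by (metis free_reduction_reduced mult_free_group)
    then have "\<not> sublist u (b @ (h @ u) @ k)"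
      using h k by (intro not_sub) auto
    then show False
      by (metis append_assoc sublist_appendI)
  qed
qed

end
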